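(* Every complete Boolean algebra (complete in the sense of ordering) is a complete algebra (closed to simple extensions) in the variety of Boolean algebras.
   Context: Let $\mathbf{M}$ be the variety of Boolean algebras. A Boolean algebra is complete in the sense of ordering if every subset has a supremum and an infimum. The notion "complete algebra (closed to simple extensions)" is the following; all algebras below belong to $\mathbf{M}$, and $A\le B$ means that $A$ is a subalgebra of $B$. For a set $S$, $W(S)$ is the free algebra in $\mathbf{M}$ on $S$; its elements are classes $[w]$ of words (terms) $w$ over $S$. The underlying set of an algebra is used as a set of free generators without its operations, and $W(A)$ is regarded as a subalgebra of $W(A\cup\{a\})$. An algebra $A'\in\mathbf{M}$ is a simple extension of $A$ with element $a$ (possibly $a\in A$), written $A'=A\sqcup a$, if $A\le A'$ and $A\cup\{a\}$ generates $A'$. $Val_A:W(A)\to A$ and $Val_{A\sqcup a}:W(A\cup\{a\})\to A\sqcup a$ are the surjective homomorphisms extending the identity maps on $A$ and on $A\cup\{a\}$ respectively; $Ker_A$ and $Ker_{A\sqcup a}$ are their kernel congruences. The set of $a$-extension conditions for $A$ (given by $A\sqcup a$) is $Ker_{A\sqcup a}|_a := Ker_{A\sqcup a}\setminus Ker_A$. If $B\le B_1$ and $B\sqcup x$ is a simple extension of $B$, an element $b\in B_1$ satisfies the $x$-extension conditions $Ker_{B\sqcup x}|_x$ if $w(b)=w'(b)$ in $B_1$ for every $([w(x)],[w'(x)])\in Ker_{B\sqcup x}|_x$, where $w(b)$ is the value in $B_1$ of the word $w$ when each letter from $B$ is interpreted as itself and $x$ is interpreted as $b$. $B_1\in\mathbf{M}$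 is a complete algebra (closed to simple extensions) in $\mathbf{M}$ if for each subalgebra $B\le B_1$ and each set of $x$-extension conditions $Ker_{B\sqcup x}|_x$ for $B$ (that is, for each simple extension $B\sqcup x\in\mathbf{M}$) there is $b\in B_1$ satisfying these conditions. *)

theory Defs
  imports Main "HOL-Library.Lub_Glb"
begin

text \<open>
  A Boolean algebra is a subset of a type of class \<^class>\<open>boolean_algebra\<close> that is closed
  under the operations; the whole type is an instance.
\<close>

definition subalgebra :: "'a::boolean_algebra set \<Rightarrow> bool" where
  "subalgebra A \<longleftrightarrow> bot \<in> A \<and> top \<in> A \<and> (\<forall>x\<in>A. - x \<in> A) \<and>
     (\<forall>x\<in>A. \<forall>y\<in>A. inf x y \<in> A) \<and> (\<forall>x\<in>A. \<forall>y\<in>A. sup x y \<in> A)"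

definition subalgebra_of :: "'a::boolean_algebra set \<Rightarrow> 'a set \<Rightarrow> bool" where
  "subalgebra_of A B \<longleftrightarrow> subalgebra A \<and> subalgebra B \<and> A \<subseteq> B"

definition simple_extension :: "'a::boolean_algebra set \<Rightarrow> 'a \<Rightarrow> 'a set \<Rightarrow> bool" where
  "simple_extension A a A' \<longleftrightarrow> subalgebra_of A A' \<and> subalgebra hull (insert a A) = A'"

definition isomorphism ::
    "('a::boolean_algebra \<Rightarrow> 'b::boolean_algebra) \<Rightarrow> 'a set \<Rightarrow> 'b set \<Rightarrow> bool" where
  "isomorphism f A B \<longleftrightarrow> bij_betw f A B \<and> f bot = bot \<and> f top = top \<and>
     (\<forall>x\<in>A. f (- x) = - f x) \<and>
     (\<forall>x\<in>A. \<forall>y\<in>A. f (inf x y) = inf (f x) (f y)) \<and>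
     (\<forall>x\<in>A. \<forall>y\<in>A. f (sup x y) = sup (f x) (f y))"

text \<open>
  Suprema and infima are taken inside \<open>B\<close>, which need not inherit them from the ambient type.
  The class \<^class>\<open>complete_boolean_algebra\<close> would be too strong here, since it includes complete
  distributivity.
\<close>

definition order_complete :: "'a::order set \<Rightarrow> bool" where
  "order_complete B \<longleftrightarrow> (\<forall>S\<subseteq>B. (\<exists>s. isLub B S s) \<and> (\<exists>i. isGlb B S i))"

datatype (letters: 'v) word =
    Letter 'v
  | Zero
  | One
  | Neg "'v word"
  | Meet "'v word" "'v word"
  | Join "'v word" "'v word"

text \<open>
  Two words denote the same element of the free algebra iff their equality is derivable from
  the Boolean algebra axioms.
\<close>

inductive word_eq :: "'v word \<Rightarrow> 'v word \<Rightarrow> bool" where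
  refl: "word_eq s s"
| sym: "word_eq s t \<Longrightarrow> word_eq t s"
| trans: "word_eq s t \<Longrightarrow> word_eq t u \<Longrightarrow> word_eq s u"
| cong_Neg: "word_eq s s' \<Longrightarrow> word_eq (Neg s) (Neg s')"
| cong_Meet: "word_eq s s' \<Longrightarrow> word_eq t t' \<Longrightarrow> word_eq (Meet s t) (Meet s' t')"
| cong_Join: "word_eq s s' \<Longrightarrow> word_eq t t' \<Longrightarrow> word_eq (Join s t) (Join s' t')"
| Meet_comm: "word_eq (Meet s t) (Meet t s)"
| Join_comm: "word_eq (Join s t) (Join t s)"
| Meet_assoc: "word_eq (Meet (Meet s t) u) (Meet s (Meet t u))"
| Join_assoc: "word_eq (Join (Join s t) u) (Join s (Join t u))"
| Meet_absorb: "word_eq (Meet s (Join s t)) s"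
| Join_absorb: "word_eq (Join s (Meet s t)) s"
| distrib: "word_eq (Join s (Meet t u)) (Meet (Join s t) (Join s u))"
| Meet_One: "word_eq (Meet s One) s"
| Join_Zero: "word_eq (Join s Zero) s"
| Meet_Neg: "word_eq (Meet s (Neg s)) Zero"
| Join_Neg: "word_eq (Join s (Neg s)) One"

quotient_type 'v free_algebra = "'v word" / word_eq
  morphisms rep_free cls
  by (intro equivpI reflpI sympI transpI) (auto intro: word_eq.intros)

lemma cls_eq_iff: "cls s = cls t \<longleftrightarrow> word_eq s t"
  by (rule free_algebra.abs_eq_iff)

text \<open>
  \<open>W S\<close> is the free algebra on \<open>S\<close>. All these algebras lie in the free algebra on the whole type,
  so that \<open>W A\<close> is literally a subset of \<open>W (insert a A)\<close>.
\<close>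

definition W :: "'v set \<Rightarrow> 'v free_algebra set" where
  "W S = cls ` {w. letters w \<subseteq> S}"

lemma W_mono: "S \<subseteq> T \<Longrightarrow> W S \<subseteq> W T"
  by (auto simp: W_def)

instantiation free_algebra :: (type) boolean_algebra
begin

lift_definition bot_free_algebra :: "'a free_algebra" is Zero .
lift_definition top_free_algebra :: "'a free_algebra" is One .
lift_definition uminus_free_algebra :: "'a free_algebra \<Rightarrow> 'a free_algebra" is Neg
  by (rule cong_Neg)
lift_definition inf_free_algebra :: "'a free_algebra \<Rightarrow> 'a free_algebra \<Rightarrow> 'a free_algebra" is Meet
  by (rule cong_Meet)
lift_definition sup_free_algebra :: "'a free_algebra \<Rightarrow> 'a free_algebra \<Rightarrow> 'a free_algebra" is Join
  by (rule cong_Join)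

definition minus_free_algebra :: "'a free_algebra \<Rightarrow> 'a free_algebra \<Rightarrow> 'a free_algebra" where
  "minus_free_algebra p q = inf p (- q)"
definition less_eq_free_algebra :: "'a free_algebra \<Rightarrow> 'a free_algebra \<Rightarrow> bool" where
  "less_eq_free_algebra p q \<longleftrightarrow> inf p q = p"
definition less_free_algebra :: "'a free_algebra \<Rightarrow> 'a free_algebra \<Rightarrow> bool" where
  "less_free_algebra p q \<longleftrightarrow> p \<le> q \<and> \<not> q \<le> p"

instance
proof
  fix p q r :: "'a free_algebra"
  have mc: "inf a b = inf b a" for a b :: "'a free_algebra"
    by transfer (rule Meet_comm)
  have jc: "sup a b = sup b a" for a b :: "'a free_algebra"
    by transfer (rule Join_comm)
  have ma: "inf (inf a b) c = inf a (inf b c)" for a b c :: "'a free_algebra"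
    by transfer (rule Meet_assoc)
  have ja: "sup (sup a b) c = sup a (sup b c)" for a b c :: "'a free_algebra"
    by transfer (rule Join_assoc)
  have mj: "inf a (sup a b) = a" for a b :: "'a free_algebra"
    by transfer (rule Meet_absorb)
  have jm: "sup a (inf a b) = a" for a b :: "'a free_algebra"
    by transfer (rule Join_absorb)
  have mi: "inf a a = a" for a :: "'a free_algebra"
    by (metis mj jm)
  have le: "a \<le> b \<longleftrightarrow> sup a b = b" for a b :: "'a free_algebra"
    unfolding less_eq_free_algebra_def by (metis mc jc mj jm)
  have m1: "inf a top = a" for a :: "'a free_algebra"
    by transfer (rule Meet_One)
  have j0: "sup a bot = a" for a :: "'a free_algebra"
    by transfer (rule Join_Zero)
  show "p < q \<longleftrightarrow> p \<le> q \<and> \<not> q \<le> p"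
    by (rule less_free_algebra_def)
  show "p \<le> p"
    by (simp add: less_eq_free_algebra_def mi)
  show "p \<le> q \<Longrightarrow> q \<le> r \<Longrightarrow> p \<le> r"
    unfolding less_eq_free_algebra_def by (metis ma)
  show "p \<le> q \<Longrightarrow> q \<le> p \<Longrightarrow> p = q"
    unfolding less_eq_free_algebra_def by (metis mc)
  show "inf p q \<le> p" "inf p q \<le> q"
    unfolding less_eq_free_algebra_def by (metis mc ma mi)+
  show "p \<le> q \<Longrightarrow> p \<le> r \<Longrightarrow> p \<le> inf q r"
    unfolding less_eq_free_algebra_def by (metis ma)
  show "p \<le> sup p q" "q \<le> sup p q"
    unfolding less_eq_free_algebra_def by (metis mj jc)+
  show "q \<le> p \<Longrightarrow> r \<le> p \<Longrightarrow> sup q r \<le> p"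
    unfolding le by (metis ja)
  show "bot \<le> p"
    unfolding le by (metis jc j0)
  show "p \<le> top"
    unfolding less_eq_free_algebra_def by (rule m1)
  show "sup p (inf q r) = inf (sup p q) (sup p r)"
    by transfer (rule distrib)
  show "inf p (- p) = bot"
    by transfer (rule Meet_Neg)
  show "sup p (- p) = top"
    by transfer (rule Join_Neg)
  show "p - q = inf p (- q)"
    by (rule minus_free_algebra_def)
qed

end

primrec value_of :: "('v \<Rightarrow> 'a::boolean_algebra) \<Rightarrow> 'v word \<Rightarrow> 'a" where
  "value_of f (Letter v) = f v"
| "value_of f Zero = bot"
| "value_of f One = top"
| "value_of f (Neg s) = - value_of f s"
| "value_of f (Meet s t) = inf (value_of f s) (value_of f t)"
| "value_of f (Join s t) = sup (value_of f s) (value_of f t)"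

text \<open>\<open>eval f\<close> is the homomorphism extending the assignment \<open>f\<close> of the letters.\<close>

lift_definition eval :: "('v \<Rightarrow> 'a::boolean_algebra) \<Rightarrow> 'v free_algebra \<Rightarrow> 'a" is value_of
  subgoal premises prems for f s t
    using prems by induction (simp_all add: ac_simps sup_inf_distrib1)
  done

lemma eval_cls [simp]: "eval f (cls w) = value_of f w"
  by (rule eval.abs_eq)

lemma eval_hom [simp]:
  "eval f bot = bot" "eval f top = top" "eval f (- p) = - eval f p"
  "eval f (inf p q) = inf (eval f p) (eval f q)"
  "eval f (sup p q) = sup (eval f p) (eval f q)"
  by (transfer; simp)+

text \<open>
  The letters are elements of an algebra interpreted as themselves. On \<open>W A\<close> and on
  \<open>W (insert a A)\<close> the map \<open>Val\<close> is the valuation onto \<open>A\<close> and onto the subalgebra generated by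
  \<open>insert a A\<close>, respectively.
\<close>

definition Val :: "'a::boolean_algebra free_algebra \<Rightarrow> 'a" where
  "Val = eval (\<lambda>v. v)"

lemma Val_image_W: "Val ` W S = subalgebra hull S"
proof
  have "value_of (\<lambda>v. v) w \<in> C" if "letters w \<subseteq> S" "subalgebra C" "S \<subseteq> C" for w C
    using that by (induction w) (auto simp: subalgebra_def)
  then show "Val ` W S \<subseteq> subalgebra hull S"
    by (auto simp: Val_def W_def hull_def)
  have eq: "Val ` W S = value_of (\<lambda>v. v) ` {w. letters w \<subseteq> S}"
    by (simp add: Val_def W_def image_image)
  have "subalgebra (value_of (\<lambda>v. v) ` {w. letters w \<subseteq> S})"
    unfolding subalgebra_def
  proof (intro conjI ballI)
    show "bot \<in> value_of (\<lambda>v. v) ` {w. letters w \<subseteq> S}"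
      by (rule image_eqI[of _ _ Zero]) auto
    show "top \<in> value_of (\<lambda>v. v) ` {w. letters w \<subseteq> S}"
      by (rule image_eqI[of _ _ One]) auto
  next
    fix x assume "x \<in> value_of (\<lambda>v. v) ` {w. letters w \<subseteq> S}"
    then obtain s where "x = value_of (\<lambda>v. v) s" "letters s \<subseteq> S" by auto
    then show "- x \<in> value_of (\<lambda>v. v) ` {w. letters w \<subseteq> S}"
      by (intro image_eqI[of _ _ "Neg s"]) auto
  next
    fix x y
    assume "x \<in> value_of (\<lambda>v. v) ` {w. letters w \<subseteq> S}" "y \<in> value_of (\<lambda>v. v) ` {w. letters w \<subseteq> S}"
    then obtain s t where "x = value_of (\<lambda>v. v) s" "letters s \<subseteq> S"
      "y = value_of (\<lambda>v. v) t" "letters t \<subseteq> S" by auto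
    then have "inf x y = value_of (\<lambda>v. v) (Meet s t)" "letters (Meet s t) \<subseteq> S"
      "sup x y = value_of (\<lambda>v. v) (Join s t)" "letters (Join s t) \<subseteq> S" by auto
    then show "inf x y \<in> value_of (\<lambda>v. v) ` {w. letters w \<subseteq> S}"
      and "sup x y \<in> value_of (\<lambda>v. v) ` {w. letters w \<subseteq> S}" by blast+
  qed
  moreover have "S \<subseteq> value_of (\<lambda>v. v) ` {w. letters w \<subseteq> S}"
    by (auto intro!: image_eqI[of _ _ "Letter _"])
  ultimately show "subalgebra hull S \<subseteq> Val ` W S"
    unfolding eq by (rule hull_minimal[rotated])
qed

definition Ker :: "'a::boolean_algebra set \<Rightarrow> ('a free_algebra \<times> 'a free_algebra) set" where
  "Ker S = {(p, q). p \<in> W S \<and> q \<in> W S \<and> Val p = Val q}"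

definition extension_conditions ::
    "'a::boolean_algebra set \<Rightarrow> 'a \<Rightarrow> ('a free_algebra \<times> 'a free_algebra) set" where
  "extension_conditions A a = Ker (insert a A) - Ker A"

text \<open>
  The element \<open>b\<close> satisfies the conditions \<open>C\<close> when the letter \<open>x\<close> is interpreted as \<open>b\<close> and any
  other letter \<open>c\<close> as \<open>\<phi> c\<close>.
\<close>

definition satisfies_conditions ::
    "('v \<Rightarrow> 'a::boolean_algebra) \<Rightarrow> 'v \<Rightarrow> ('v free_algebra \<times> 'v free_algebra) set \<Rightarrow> 'a \<Rightarrow> bool" where
  "satisfies_conditions \<phi> x C b \<longleftrightarrow> (\<forall>(p, q)\<in>C. eval (\<phi>(x := b)) p = eval (\<phi>(x := b)) q)"

text \<open>
  Simple extensions of a subalgebra \<open>B\<close> of \<open>B1\<close> need not fit into the type of \<open>B1\<close>, so they are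
  formed in an arbitrary second type, in which \<open>B\<close> is represented by an isomorphic copy \<open>A\<close>; a
  letter \<open>c\<close> from \<open>A\<close> stands for the element \<open>\<phi> c\<close> of \<open>B\<close>. The property is meant for every choice
  of the second type. For equal types and \<open>\<phi>\<close> the identity, \<open>A\<close> is \<open>B\<close> itself.
\<close>

definition closed_to_simple_extensions ::
    "'b::boolean_algebra itself \<Rightarrow> 'a::boolean_algebra set \<Rightarrow> bool" where
  "closed_to_simple_extensions (_ :: 'b itself) B1 \<longleftrightarrow>
     (\<forall>B (A :: 'b set) \<phi> x A'.
        subalgebra_of B B1 \<longrightarrow> isomorphism \<phi> A B \<longrightarrow> simple_extension A x A' \<longrightarrow>
        (\<exists>b\<in>B1. satisfies_conditions \<phi> x (extension_conditions A x) b))"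

end

theory Submission
  imports Defs
begin

text \<open>
  A word \<open>w\<close> vanishes at \<open>x\<close> iff \<open>w(bot) \<le> x \<le> - w(top)\<close>. For \<open>x\<close> outside
  the base algebra the extension conditions therefore say only which elements of it lie below and
  above \<open>x\<close>, and the supremum of the elements below \<open>x\<close> satisfies them. For \<open>x\<close> inside it there
  are no conditions.
\<close>

text \<open>Meeting with \<open>e\<close> is a homomorphism onto the algebra of elements below
  \<open>e\<close>, whose complement is \<open>inf (- y) e\<close>. Hence the part of a value below
  \<open>e\<close> depends only on the parts of the letters below \<open>e\<close>.\<close>

lemma value_of_inf_cong:
  assumes "\<And>v. v \<in> letters w \<Longrightarrow> inf (f v) e = inf (g v) e"
  shows "inf (value_of f w) e = inf (value_of g w) e"
  using assms
proof (induction w)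
  case (Neg s)
  have "inf (- y) e = inf (- inf y e) e" for y
    by (simp add: inf_sup_distrib2)
  from this[of "value_of f s"] this[of "value_of g s"] Neg show ?case by simp
next
  case (Meet s t)
  have "inf (inf y z) e = inf (inf y e) (inf z e)" for y z
    by (simp add: ac_simps)
  with Meet show ?case by simp
qed (simp_all add: inf_sup_distrib2)

text \<open>Boole's expansion: below \<open>b\<close> the letter \<open>x\<close> may be read as
  \<open>top\<close>, below \<open>- b\<close> as \<open>bot\<close>, and a value vanishes iff both
  of its parts do.\<close>

lemma value_of_eq_bot_iff:
  "value_of (f(x := b)) w = bot \<longleftrightarrow>
     value_of (f(x := bot)) w \<le> b \<and> b \<le> - value_of (f(x := top)) w"
proof -
  have "value_of (f(x := b)) w = bot \<longleftrightarrow>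
      inf (value_of (f(x := b)) w) b = bot \<and> inf (value_of (f(x := b)) w) (- b) = bot"
    (is "?X = _ \<longleftrightarrow> _")
  proof -
    \<comment> \<open>\<open>inf_shunt\<close> turns \<open>?X \<le> - b\<close> and
      \<open>?X \<le> - (- b)\<close> into the vanishing of the two parts.\<close>
    have "?X = bot \<longleftrightarrow> ?X \<le> inf (- b) b"
      by (simp add: bot_unique)
    then show ?thesis
      unfolding inf_shunt le_inf_iff double_compl .
  qed
  moreover have "inf (value_of (f(x := b)) w) b = inf (value_of (f(x := top)) w) b"
    and "inf (value_of (f(x := b)) w) (- b) = inf (value_of (f(x := bot)) w) (- b)"
    by (rule value_of_inf_cong; simp)+
  ultimately show ?thesis
    by (auto simp: inf_shunt intro: compl_le_swap1)
qed

lemma value_of_in_subalgebra: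
  assumes "subalgebra A" "\<And>v. v \<in> letters w \<Longrightarrow> f v \<in> A"
  shows "value_of f w \<in> A"
  using assms(2) by (induction w) (use assms(1) in \<open>auto simp: subalgebra_def\<close>)

lemma isomorphism_value_of:
  assumes "isomorphism \<phi> A B" "subalgebra A"
    and "\<And>v. v \<in> letters w \<Longrightarrow> f v \<in> A" "\<And>v. v \<in> letters w \<Longrightarrow> g v = \<phi> (f v)"
  shows "value_of g w = \<phi> (value_of f w)"
  using assms(3,4)
  by (induction w)
    (use assms(1) in \<open>simp_all add: isomorphism_def value_of_in_subalgebra[OF assms(2)]\<close>)

lemma isomorphism_mono:
  assumes "isomorphism \<phi> A B" "y \<in> A" "z \<in> A" "y \<le> z"
  shows "\<phi> y \<le> \<phi> z"
  using assms unfolding isomorphism_def by (metis inf.absorb_iff1)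

theorem proposition6:
  fixes B1 :: "'a::boolean_algebra set"
  assumes "subalgebra B1"
    and "order_complete B1"
  shows "closed_to_simple_extensions TYPE('b::boolean_algebra) B1"
  unfolding closed_to_simple_extensions_def
proof (intro allI impI)
  fix B and A :: "'b set" and \<phi> x A'
  assume B: "subalgebra_of B B1" and iso: "isomorphism \<phi> A B" and ext: "simple_extension A x A'"
  have A: "subalgebra A"
    using ext by (simp add: simple_extension_def subalgebra_of_def)
  have \<phi>: "\<phi> c \<in> B1" if "c \<in> A" for c
    using that B iso by (auto simp: isomorphism_def subalgebra_of_def bij_betw_def)
  show "\<exists>b\<in>B1. satisfies_conditions \<phi> x (extension_conditions A x) b"
  proof (cases "x \<in> A")
    case True
    then have "extension_conditions A x = {}"
      by (simp add: extension_conditions_def insert_absorb)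
    moreover have "bot \<in> B1"
      using assms(1) by (simp add: subalgebra_def)
    ultimately show ?thesis
      by (auto simp: satisfies_conditions_def)
  next
    case False
    let ?S = "\<phi> ` {c \<in> A. c \<le> x}"
    obtain b where b: "isLub B1 ?S b"
      using assms(2) \<phi> unfolding order_complete_def by (metis (lifting) image_subsetI mem_Collect_eq)
    have bB: "b \<in> B1"
      using b by (rule isLubD1a)
    \<comment> \<open>Words of value \<open>bot\<close> suffice, since \<open>s = t\<close> means
      that \<open>s \<sqinter> - t\<close> and \<open>t \<sqinter> - s\<close> vanish.\<close>
    have vanish: "value_of (\<phi>(x := b)) w = bot"
      if w: "letters w \<subseteq> insert x A" and 0: "value_of (\<lambda>v. v) w = bot" for w
    proof -
      let ?v = "\<lambda>e. value_of ((\<lambda>v. v)(x := e)) w"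
      have inA: "?v e \<in> A" if "e \<in> A" for e
        by (rule value_of_in_subalgebra[OF A]) (use w that in auto)
      \<comment> \<open>\<open>\<phi>\<close> respects the operations only on \<open>A\<close>, so
        it is applied not at \<open>x\<close> but at the bounds, which arise from
        \<open>e = bot\<close> and \<open>e = top\<close>.\<close>
      have nat: "value_of (\<phi>(x := \<phi> e)) w = \<phi> (?v e)" if "e \<in> A" for e
        by (rule isomorphism_value_of[OF iso A]) (use w that in auto)
      have bt: "bot \<in> A" "top \<in> A" and "\<phi> bot = bot" "\<phi> top = top"
        using A iso by (simp_all add: subalgebra_def isomorphism_def)
      with nat[of bot] nat[of top]
      have val: "value_of (\<phi>(x := bot)) w = \<phi> (?v bot)" "value_of (\<phi>(x := top)) w = \<phi> (?v top)"
        by simp_all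
      have "?v x = bot"
        using 0 by (simp add: fun_upd_idem)
      then have x: "?v bot \<le> x" "x \<le> - ?v top"
        unfolding value_of_eq_bot_iff by auto
      \<comment> \<open>The lower bound for \<open>x\<close> lies in \<open>A\<close>, so its image
        belongs to \<open>?S\<close>.\<close>
      have "\<phi> (?v bot) \<le> b"
        using b by (rule isLubD2) (use x inA bt in auto)
      moreover have "b \<le> \<phi> (- ?v top)"
      \<comment> \<open>Leastness of \<open>b\<close> holds among upper bounds in \<open>B1\<close>;
        the image of \<open>- ?v top\<close> is one because \<open>- ?v top\<close> lies in
        \<open>A\<close> and above \<open>x\<close>.\<close>
      proof (rule isLub_le_isUb[OF b])
        have top: "- ?v top \<in> A"
          using A inA bt by (simp add: subalgebra_def)
        have "\<phi> c \<le> \<phi> (- ?v top)" if "c \<in> A" "c \<le> x" for c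
          using that top x(2) by (meson isomorphism_mono[OF iso] order_trans)
        then show "isUb B1 ?S (\<phi> (- ?v top))"
          using \<phi>[OF top] by (auto intro!: isUbI setleI)
      qed
      moreover have "\<phi> (- ?v top) = - \<phi> (?v top)"
        using iso inA bt by (simp add: isomorphism_def)
      ultimately show ?thesis
        unfolding value_of_eq_bot_iff val by simp
    qed
    have le: "value_of (\<phi>(x := b)) s \<le> value_of (\<phi>(x := b)) t"
      if "letters s \<subseteq> insert x A" "letters t \<subseteq> insert x A"
        "value_of (\<lambda>v. v) s = value_of (\<lambda>v. v) t" for s t
      using vanish[of "Meet s (Neg t)"] that by (simp add: inf_shunt)
    have "satisfies_conditions \<phi> x (extension_conditions A x) b"
      unfolding satisfies_conditions_def extension_conditions_def Ker_def W_def Val_def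
      by (auto intro!: antisym le)
    with bB show ?thesis ..
  qed
qed

end
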